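(* Let $B\in M_n(\mathbb{R})$ be an expanding matrix with $|\det B|\in\mathbb{Z}$ and let $\mathcal{D}\subset\mathbb{R}^n$ be a finite set with $0\in\mathcal{D}$ and $\mathrm{card}(\mathcal{D})=|\det B|$. Let $K=K(B,\mathcal{D})$ and let $\mu$ be the measure associated with $(B,\mathcal{D})$. Then $|K|^{-1}=D^+(\mu)$, i.e. $|K|=(D^+(\mu))^{-1}$, with the convention that $|K|=0$ if $D^+(\mu)=\infty$.
   Context: $M_n(\mathbb{R})$ is the set of real $n\times n$ matrices. A matrix $B$ is expanding if all its (complex) eigenvalues $\lambda$ satisfy $|\lambda|>1$. $K(B,\mathcal{D})$ is the unique non-empty compact set $K\subset\mathbb{R}^n$ with $BK=\bigcup_{d\in\mathcal{D}}(K+d)$. $|E|$ denotes the Lebesgue measure of a measurable set $E\subset\mathbb{R}^n$. The measure $\mu$ is $$\mu=\lim_{s\to\infty}\sum_{\ell_0,\dots,\ell_{s-1}\in\mathcal{D}}\delta_{\ell_0+B\ell_1+\dots+B^{s-1}\ell_{s-1}},$$ where $\delta_x$ is the Dirac measure at $x$; points are counted with multiplicity (one for each tuple). Since $0\in\mathcal{D}$ the approximating measures are increasing in $s$, and $\mu$ is their setwise limit, with values in $[0,\infty]$. For a positive Borel measure $\mu$ on $\mathbb{R}^n$, the upper Beurling density is $$D^+(\mu)=\limsup_{N\to\infty}\sup_{z\in\mathbb{R}^n}\frac{\mu(I_N(z))}{N^n},\qquad I_N(z)=\{y\in\mathbb{R}^n: |y_i-z_i|\le N/2,\ i=1,\dots,n\}.$$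 *)

theory Defs
  imports "HOL-Probability.Probability"
begin

definition complex_eigenvalue :: "real ^ 'n ^ 'n \<Rightarrow> complex \<Rightarrow> bool" where
  "complex_eigenvalue B z \<longleftrightarrow>
     (\<exists>v::complex ^ 'n. v \<noteq> 0 \<and> map_matrix complex_of_real B *v v = z *s v)"

definition expanding :: "real ^ 'n ^ 'n \<Rightarrow> bool" where
  "expanding B \<longleftrightarrow> (\<forall>z. complex_eigenvalue B z \<longrightarrow> 1 < cmod z)"

text \<open>
  The description below is meaningful when \<open>B\<close> is expanding and \<open>D\<close> is finite and non-empty:
  \<open>K\<close> is then the attractor of the maps \<open>x \<mapsto> B\<^sup>-\<^sup>1 (x + d)\<close>, which are contractions for a
  suitable norm.
\<close>

definition self_affine_set :: "real ^ 'n ^ 'n \<Rightarrow> (real ^ 'n) set \<Rightarrow> (real ^ 'n) set" where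
  "self_affine_set B D =
     (THE K. compact K \<and> K \<noteq> {} \<and> (\<lambda>x. B *v x) ` K = (\<Union>d\<in>D. (\<lambda>x. x + d) ` K))"

text \<open>
  A tuple of \<open>s\<close> digits is an extensional function on \<open>{..<s}\<close>; \<open>B\<^sup>j\<close> is the \<open>j\<close>-fold iterate
  of \<open>(*v) B\<close>, since the power operation on type \<open>real ^ 'n ^ 'n\<close> is the entrywise one.
\<close>

definition digit_expansion :: "real ^ 'n ^ 'n \<Rightarrow> nat \<Rightarrow> (nat \<Rightarrow> real ^ 'n) \<Rightarrow> real ^ 'n" where
  "digit_expansion B s l = (\<Sum>j<s. (((*v) B) ^^ j) (l j))"

definition digit_measure_approx ::
    "real ^ 'n ^ 'n \<Rightarrow> (real ^ 'n) set \<Rightarrow> nat \<Rightarrow> (real ^ 'n) measure" where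
  "digit_measure_approx B D s = measure_of UNIV (sets borel)
     (\<lambda>A. \<Sum>l\<in>{..<s} \<rightarrow>\<^sub>E D. emeasure (return borel (digit_expansion B s l)) A)"

definition digit_measure :: "real ^ 'n ^ 'n \<Rightarrow> (real ^ 'n) set \<Rightarrow> (real ^ 'n) measure" where
  "digit_measure B D = measure_of UNIV (sets borel)
     (\<lambda>A. lim (\<lambda>s. emeasure (digit_measure_approx B D s) A))"

definition cube :: "real \<Rightarrow> real ^ 'n \<Rightarrow> (real ^ 'n) set" where
  "cube N z = {y. \<forall>i. \<bar>y $ i - z $ i\<bar> \<le> N / 2}"

definition upper_Beurling_density :: "(real ^ 'n) measure \<Rightarrow> ennreal" where
  "upper_Beurling_density M =
     Limsup at_top (\<lambda>N::real. SUP z. emeasure M (cube N z) / ennreal (N ^ CARD('n)))"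

text \<open>
  The two set functions handed to \<^const>\<open>measure_of\<close> are countably additive on the Borel sets,
  so they really are the values of the resulting measures.
\<close>

lemma sets_digit_measure_approx [simp, measurable_cong]:
    "sets (digit_measure_approx B D s) = sets borel"
  and space_digit_measure_approx [simp]: "space (digit_measure_approx B D s) = UNIV"
  and sets_digit_measure [simp, measurable_cong]: "sets (digit_measure B D) = sets borel"
  and space_digit_measure [simp]: "space (digit_measure B D) = UNIV"
  using sets.sigma_sets_eq[of "borel :: (real ^ 'n) measure"]
  by (simp_all add: digit_measure_approx_def digit_measure_def sets_measure_of_conv
      space_measure_of_conv)

lemma emeasure_digit_measure_approx:
  assumes A: "A \<in> sets borel"
  shows "emeasure (digit_measure_approx B D s) A =
         (\<Sum>l\<in>{..<s} \<rightarrow>\<^sub>E D. indicator A (digit_expansion B s l))"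
proof -
  let ?f = "\<lambda>A. \<Sum>l\<in>{..<s} \<rightarrow>\<^sub>E D. emeasure (return borel (digit_expansion B s l)) A"
  have "emeasure (digit_measure_approx B D s) A = ?f A"
  proof (rule emeasure_measure_of[OF digit_measure_approx_def])
    show "countably_additive (sets (digit_measure_approx B D s)) ?f"
    proof (rule countably_additiveI)
      fix F :: "nat \<Rightarrow> (real ^ 'a) set"
      assume F: "range F \<subseteq> sets (digit_measure_approx B D s)" "disjoint_family F"
      have "(\<Sum>i. ?f (F i)) =
          (\<Sum>l\<in>{..<s} \<rightarrow>\<^sub>E D. \<Sum>i. emeasure (return borel (digit_expansion B s l)) (F i))"
        by (rule suminf_sum) simp
      also have "\<dots> = ?f (\<Union> (range F))"
        using F by (intro sum.cong refl suminf_emeasure) auto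
      finally show "(\<Sum>i. ?f (F i)) = ?f (\<Union> (range F))" .
    qed
  qed (use A in \<open>auto simp: positive_def\<close>)
  then show ?thesis using A by simp
qed

lemma incseq_digit_measure_approx:
  assumes A: "A \<in> sets borel" and D: "finite D" "0 \<in> D"
  shows "incseq (\<lambda>s. emeasure (digit_measure_approx B D s) A)"
proof (rule incseq_SucI)
  fix s :: nat
  let ?e = "\<lambda>l :: nat \<Rightarrow> real ^ 'a. l(s := 0 :: real ^ 'a)"
  have e: "digit_expansion B (Suc s) (?e l) = digit_expansion B s l" for l
  proof -
    have "(((*v) B) ^^ s) 0 = 0" by (induction s) auto
    moreover have "(\<Sum>j<s. (((*v) B) ^^ j) (?e l j)) = (\<Sum>j<s. (((*v) B) ^^ j) (l j))"
      by (intro sum.cong) auto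
    ultimately show ?thesis by (simp add: digit_expansion_def)
  qed
  have inj: "inj_on ?e ({..<s} \<rightarrow>\<^sub>E D)"
  proof (rule inj_onI)
    fix l l' assume l: "l \<in> {..<s} \<rightarrow>\<^sub>E D" "l' \<in> {..<s} \<rightarrow>\<^sub>E D" "?e l = ?e l'"
    show "l = l'"
    proof (rule PiE_ext[OF l(1,2)])
      fix j assume "j \<in> {..<s}"
      then show "l j = l' j" using fun_cong[OF l(3), of j] by auto
    qed
  qed
  have sub: "?e ` ({..<s} \<rightarrow>\<^sub>E D) \<subseteq> {..<Suc s} \<rightarrow>\<^sub>E D"
  proof (rule image_subsetI)
    fix l :: "nat \<Rightarrow> real ^ 'a" assume l: "l \<in> {..<s} \<rightarrow>\<^sub>E D"
    show "?e l \<in> {..<Suc s} \<rightarrow>\<^sub>E D"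
    proof (rule PiE_I)
      fix j assume "j \<in> {..<Suc s}"
      then show "?e l j \<in> D" using PiE_mem[OF l, of j] D(2) by (cases "j = s") simp_all
    next
      fix j assume "j \<notin> {..<Suc s}"
      then show "?e l j = undefined" using PiE_arb[OF l, of j] by simp
    qed
  qed
  have "(\<Sum>l\<in>{..<s} \<rightarrow>\<^sub>E D. indicator A (digit_expansion B s l) :: ennreal) =
        (\<Sum>l\<in>?e ` ({..<s} \<rightarrow>\<^sub>E D). indicator A (digit_expansion B (Suc s) l))"
    by (simp add: sum.reindex[OF inj] e)
  also have "\<dots> \<le> (\<Sum>l\<in>{..<Suc s} \<rightarrow>\<^sub>E D. indicator A (digit_expansion B (Suc s) l))"
    by (rule sum_mono2[OF _ sub]) (simp_all add: finite_PiE D)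
  finally show "emeasure (digit_measure_approx B D s) A
      \<le> emeasure (digit_measure_approx B D (Suc s)) A"
    using A by (simp add: emeasure_digit_measure_approx)
qed

lemma emeasure_digit_measure:
  assumes A: "A \<in> sets borel" and D: "finite D" "0 \<in> D"
  shows "emeasure (digit_measure B D) A = (SUP s. emeasure (digit_measure_approx B D s) A)"
proof -
  let ?\<mu> = "\<lambda>s. emeasure (digit_measure_approx B D s)"
  have lim: "lim (\<lambda>s. ?\<mu> s A) = (SUP s. ?\<mu> s A)" if "A \<in> sets borel" for A
    by (rule limI LIMSEQ_SUP incseq_digit_measure_approx that D)+
  have "emeasure (digit_measure B D) A = lim (\<lambda>s. ?\<mu> s A)"
  proof (rule emeasure_measure_of[OF digit_measure_def])
    show "countably_additive (sets (digit_measure B D)) (\<lambda>A. lim (\<lambda>s. ?\<mu> s A))"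
    proof (rule countably_additiveI)
      fix F :: "nat \<Rightarrow> (real ^ 'a) set"
      assume F: "range F \<subseteq> sets (digit_measure B D)" "disjoint_family F"
        "\<Union> (range F) \<in> sets (digit_measure B D)"
      have Fi: "F i \<in> sets borel" for i using F by auto
      have "(\<Sum>i. lim (\<lambda>s. ?\<mu> s (F i))) = (\<Sum>i. SUP s. ?\<mu> s (F i))"
        using Fi by (simp add: lim)
      also have "\<dots> = (SUP s. \<Sum>i. ?\<mu> s (F i))"
        by (rule ennreal_suminf_SUP_eq incseq_digit_measure_approx Fi D)+
      also have "\<dots> = (SUP s. ?\<mu> s (\<Union> (range F)))"
        using F by (intro SUP_cong refl suminf_emeasure) auto
      also have "\<dots> = lim (\<lambda>s. ?\<mu> s (\<Union> (range F)))"
        using F by (simp add: lim)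
      finally show "(\<Sum>i. lim (\<lambda>s. ?\<mu> s (F i))) = lim (\<lambda>s. ?\<mu> s (\<Union> (range F)))" .
    qed
  qed (use A in \<open>auto simp: positive_def\<close>)
  then show ?thesis using A lim by simp
qed

end

theory Submission
  imports Defs "HOL-Computational_Algebra.Fundamental_Theorem_Algebra"
begin

text \<open>
  Write \<open>q = card D = |det B|\<close>, let \<open>x\<^sub>l\<close> be the digit expansion of a tuple \<open>l\<close> of \<open>s\<close> digits, and let \<open>\<mu>\<^sub>s\<close>
  be the measure counting the \<open>q\<^sup>s\<close> points \<open>x\<^sub>l\<close>. Iterating the set equation gives
  \<open>B\<^sup>s K = \<Union>\<^sub>l (K + x\<^sub>l)\<close>, a union of \<open>q\<^sup>s\<close> translates of \<open>K\<close> whose measure is exactly \<open>q\<^sup>s |K|\<close>.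

  So the translates do not overlap in measure and, if \<open>|K| > 0\<close>, at most \<open>(N + 2 r)\<^sup>n / |K|\<close> of the points \<open>x\<^sub>l\<close> lie in
  a cube of side \<open>N\<close>, when \<open>K\<close> is contained in the ball of radius \<open>r\<close>; this is
  \<open>card_times_measure_le\<close>, and dividing by \<open>N\<^sup>n\<close> shows \<open>D\<^sup>+(\<mu>) \<le> 1 / |K|\<close>.

  Conversely, the integral of \<open>\<mu>\<^sub>s(I\<^sub>N(z))\<close> over \<open>z\<close> is \<open>q\<^sup>s N\<^sup>n\<close>, while the integrand vanishes outside
  \<open>B\<^sup>s U\<close> for a neighbourhood \<open>U\<close> of \<open>K\<close> that may be taken arbitrarily tight as \<open>s\<close> grows. As
  \<open>|B\<^sup>s U| = q\<^sup>s |U|\<close>, some cube has \<open>\<mu>\<^sub>s(I\<^sub>N(z)) / N\<^sup>n\<close> at least nearly \<open>1 / |K|\<close>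
  (arbitrarily large, if \<open>|K| = 0\<close>); this is \<open>cube_volume_le\<close>.

  Two preliminaries support this. The eigenvalue condition is turned into summability of
  \<open>|B\<^sup>-\<^sup>k v|\<close> (\<open>expanding_inverse_powers_summable\<close>), from which the attractor is obtained as the closure
  of the set of finite radix expansions and shown to be unique (\<open>self_affine_set_eq\<close>). Linear maps
  scale Lebesgue measure by \<open>|det|\<close> (\<open>measure_matrix_image\<close>).
\<close>

section \<open>Linear images of Lebesgue measurable sets\<close>

text \<open>
  A map multiplies Lebesgue measure by the absolute value of the determinant of its matrix. As
  opposed to \<open>measure_linear_image\<close>, no order on the index type \<open>'n\<close> is assumed here.
\<close>

definition scales_measure_by_det :: "(real ^ 'n \<Rightarrow> real ^ 'n) \<Rightarrow> bool" where
  "scales_measure_by_det f \<longleftrightarrow>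
     (\<forall>S\<in>lmeasurable. f ` S \<in> lmeasurable \<and>
        measure lebesgue (f ` S) = \<bar>det (matrix f)\<bar> * measure lebesgue S)"

lemma scales_measure_by_detI:
  assumes "linear f"
    and "\<And>a b. cbox a b \<noteq> {} \<Longrightarrow>
           measure lebesgue (f ` cbox a b) = \<bar>det (matrix f)\<bar> * measure lebesgue (cbox a b)"
  shows "scales_measure_by_det f"
  unfolding scales_measure_by_det_def
proof
  fix S :: "(real ^ 'a) set" assume S: "S \<in> lmeasurable"
  have "measure lebesgue (f ` cbox a b) = \<bar>det (matrix f)\<bar> * measure lebesgue (cbox a b)" for a b
    using assms(2)[of a b] by (cases "cbox a b = {}") auto
  from measure_linear_sufficient[OF assms(1) S this]
  show "f ` S \<in> lmeasurable \<and> measure lebesgue (f ` S) = \<bar>det (matrix f)\<bar> * measure lebesgue S"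
    by simp
qed

lemma scales_measure_by_det_coordinate_swap:
  "scales_measure_by_det (\<lambda>x :: real ^ 'n. \<chi> i. x $ Transposition.transpose m n i)"
    (is "scales_measure_by_det ?h")
proof (rule scales_measure_by_detI)
  show lin: "linear ?h" by (rule linearI) (simp_all add: vec_eq_iff)
  have inv: "?h \<circ> ?h = id" by (simp add: fun_eq_iff vec_eq_iff)
  have "det (matrix ?h) * det (matrix ?h) = 1"
    by (simp only: det_mul[symmetric] matrix_compose[OF lin lin, symmetric] inv matrix_id_mat_1 det_I)
  then have det: "\<bar>det (matrix ?h)\<bar> = 1"
    using power2_eq_1_iff[of "det (matrix ?h)"] by (auto simp: power2_eq_square)
  fix a b :: "real ^ 'n" assume ne: "cbox a b \<noteq> {}"
  have "x \<in> ?h ` S \<longleftrightarrow> ?h x \<in> S" for x S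
    using inv by (metis (no_types, lifting) comp_apply id_apply image_iff)
  moreover have "?h x \<in> cbox a b \<longleftrightarrow> x \<in> cbox (?h a) (?h b)" for x
    by (simp add: mem_box_cart) (metis transpose_involutory)
  ultimately have eq: "?h ` cbox a b = cbox (?h a) (?h b)" by blast
  with ne have "cbox (?h a) (?h b) \<noteq> {}" by blast
  then have "measure lebesgue (?h ` cbox a b) =
      (\<Prod>i\<in>UNIV. (b - a) $ Transposition.transpose m n i)"
    by (simp add: eq content_cbox_cart)
  also have "\<dots> = (\<Prod>i\<in>UNIV. (b - a) $ i)"
    using prod.permute[OF permutes_swap_id[of m UNIV n], of "\<lambda>i. (b - a) $ i"] by (simp add: o_def)
  also have "\<dots> = measure lebesgue (cbox a b)"
    using ne by (simp add: content_cbox_cart)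
  finally show "measure lebesgue (?h ` cbox a b) =
      \<bar>det (matrix ?h)\<bar> * measure lebesgue (cbox a b)"
    by (simp add: det)
qed

text \<open>
  The determinant is computed by a row operation, so that no ordering of the coordinates is
  needed to see the matrix as triangular.
\<close>

lemma scales_measure_by_det_shear:
  assumes "m \<noteq> n"
  shows "scales_measure_by_det (\<lambda>x :: real ^ 'n. \<chi> i. if i = m then x $ m + x $ n else x $ i)"
    (is "scales_measure_by_det ?h")
proof (rule scales_measure_by_detI)
  show lin: "linear ?h" by (rule linearI) (simp_all add: vec_eq_iff algebra_simps)
  have "matrix ?h = (\<chi> k. if k = m then row m (mat 1) + 1 *s row n (mat 1) else row k (mat 1))"
    by (auto simp: matrix_def row_def mat_def axis_def vec_eq_iff)
  then have det: "det (matrix ?h) = 1"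
    using det_row_operation[OF assms, where A = "mat 1"] by simp
  fix a b :: "real ^ 'n" assume ne: "cbox a b \<noteq> {}"
  \<comment> \<open>\<open>measure_shear_interval\<close> wants \<open>a $ n \<ge> 0\<close>; translating by \<open>v\<close> makes this coordinate zero.\<close>
  define v where "v = axis n (a $ n)"
  have box: "cbox a b = (+) v ` cbox (a - v) (b - v)"
    using cbox_translation[of v "a - v" "b - v"] by simp
  have "?h ` cbox a b = (+) (?h v) ` ?h ` cbox (a - v) (b - v)"
    unfolding box image_image by (simp only: linear_add[OF lin])
  then have "measure lebesgue (?h ` cbox a b) = measure lebesgue (?h ` cbox (a - v) (b - v))"
    by (simp only: measure_translation)
  also have "\<dots> = measure lebesgue (cbox (a - v) (b - v))"
    using ne assms by (intro measure_shear_interval) (auto simp: box v_def)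
  also have "\<dots> = measure lebesgue (cbox a b)"
    by (simp only: box measure_translation)
  finally show "measure lebesgue (?h ` cbox a b) =
      \<bar>det (matrix ?h)\<bar> * measure lebesgue (cbox a b)"
    by (simp add: det)
qed

lemma scales_measure_by_det_linear:
  fixes f :: "real ^ 'n \<Rightarrow> real ^ 'n"
  assumes "linear f"
  shows "scales_measure_by_det f"
  using assms
proof (rule induct_linear_elementary)
  fix f g :: "real ^ 'n \<Rightarrow> real ^ 'n"
  assume "linear f" "linear g" "scales_measure_by_det f" "scales_measure_by_det g"
  then show "scales_measure_by_det (f \<circ> g)"
    unfolding scales_measure_by_det_def
    by (simp only: image_comp[symmetric] matrix_compose det_mul abs_mult mult.assoc) simp
next
  fix f :: "real ^ 'n \<Rightarrow> real ^ 'n" and i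
  assume f: "linear f" "\<And>x. f x $ i = 0"
  have "axis i 1 \<notin> range f" using f(2) by (metis axis_nth imageE zero_neq_one)
  then have inj: "\<not> inj f" using f(1) linear_injective_imp_surjective by blast
  then have "det (matrix f) = 0" using det_nz_iff_inj[OF f(1)] by blast
  moreover have "negligible (f ` S)" for S
    by (rule negligible_linear_singular_image[OF f(1) inj])
  ultimately show "scales_measure_by_det f"
    by (simp add: scales_measure_by_det_def negligible_iff_measure)
next
  fix c :: "'n \<Rightarrow> real"
  have "det (matrix (\<lambda>x :: real ^ 'n. \<chi> i. c i * x $ i)) = (\<Prod>i\<in>UNIV. c i)"
    by (subst det_diagonal) (auto simp: matrix_def axis_def)
  then show "scales_measure_by_det (\<lambda>x :: real ^ 'n. \<chi> i. c i * x $ i)"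
    by (simp add: scales_measure_by_det_def measurable_stretch measure_stretch)
qed (rule scales_measure_by_det_coordinate_swap scales_measure_by_det_shear; assumption?)+

lemma
  fixes A :: "real ^ 'n ^ 'n"
  assumes "S \<in> lmeasurable"
  shows lmeasurable_matrix_image: "(*v) A ` S \<in> lmeasurable"
    and measure_matrix_image: "measure lebesgue ((*v) A ` S) = \<bar>det A\<bar> * measure lebesgue S"
  using scales_measure_by_det_linear[OF matrix_vector_mul_linear, of A] assms
  by (auto simp: scales_measure_by_det_def)

section \<open>Inverse powers of an expanding matrix\<close>

text \<open>
  \<open>poly_act C p v\<close> is \<open>p(C) v\<close>, evaluated by Horner's scheme.
\<close>

definition poly_act :: "complex ^ 'n ^ 'n \<Rightarrow> complex poly \<Rightarrow> complex ^ 'n \<Rightarrow> complex ^ 'n" where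
  "poly_act C p v = fold_coeffs (\<lambda>a w. a *s v + C *v w) p 0"

lemma poly_act_0 [simp]: "poly_act C 0 v = 0"
  by (simp add: poly_act_def)

lemma poly_act_pCons [simp]: "poly_act C (pCons a p) v = a *s v + C *v poly_act C p v"
  by (cases "p = 0 \<and> a = 0") (auto simp: poly_act_def)

lemma poly_act_add: "poly_act C (p + q) v = poly_act C p v + poly_act C q v"
proof (induction p arbitrary: q)
  case (pCons a p)
  show ?case
    by (cases q) (simp add: pCons.IH vec.scale_left_distrib matrix_vector_right_distrib)
qed simp

lemma poly_act_smult: "poly_act C (smult c p) v = c *s poly_act C p v"
  by (induction p) (simp_all add: vec.scale_right_distrib vector_scalar_commute)

lemma poly_act_sum: "poly_act C (\<Sum>i\<in>I. f i) v = (\<Sum>i\<in>I. poly_act C (f i) v)"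
  by (induction I rule: infinite_finite_induct) (simp_all add: poly_act_add)

lemma poly_act_monom: "poly_act C (monom c i) v = c *s ((*v) C ^^ i) v"
  by (induction i) (simp_all add: monom_0 monom_Suc vector_scalar_commute)

lemma poly_act_linear_factor:
  "poly_act C ([:- z, 1:] * p) v = C *v poly_act C p v - z *s poly_act C p v"
proof -
  have "[:- z, 1:] * p = smult (- z) p + pCons 0 p" by simp
  then show ?thesis
    by (simp only: poly_act_add poly_act_smult poly_act_pCons) (simp add: vec.scale_minus_left)
qed

lemma norm_vector_scalar_mult: "norm (c *s v) = cmod c * norm (v :: complex ^ 'n)"
  by (simp add: norm_vec_def norm_mult L2_set_right_distrib)

lemma poly_act_matrix: "poly_act C p (C *v v) = C *v poly_act C p v"
  by (induction p) (simp_all add: matrix_vector_right_distrib vector_scalar_commute)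

text \<open>
  The \<open>n + 1\<close> vectors \<open>v, C v, \<dots>, C\<^sup>n v\<close> of an \<open>n\<close>-dimensional space are linearly dependent. If two of
  them coincide, they span too small a set for a dimension count, and that case is treated apart.
\<close>

lemma annihilating_poly_exists:
  fixes C :: "complex ^ 'n ^ 'n"
  shows "\<exists>p. p \<noteq> 0 \<and> poly_act C p v = 0"
proof (cases "inj_on (\<lambda>i. ((*v) C ^^ i) v) {..CARD('n)}")
  case False
  then obtain i j where ij: "((*v) C ^^ i) v = ((*v) C ^^ j) v" "i \<noteq> j"
    by (auto simp: inj_on_def)
  let ?p = "monom 1 i + monom (- 1) j :: complex poly"
  have "coeff ?p i \<noteq> 0" using ij by simp
  then have "?p \<noteq> 0" by (metis coeff_0)
  moreover have "poly_act C ?p v = 0"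
    by (simp only: poly_act_add poly_act_monom ij) simp
  ultimately show ?thesis by blast
next
  case True
  let ?f = "\<lambda>i. ((*v) C ^^ i) v"
  let ?S = "?f ` {..CARD('n)}"
  have "card ?S = Suc CARD('n)" using True by (simp add: card_image)
  moreover have "vec.dim ?S \<le> CARD('n)"
    using vec.dim_subset_UNIV[of ?S] by (simp add: card_cart_basis vec.dimension_def)
  ultimately have "vec.dependent ?S"
    by (intro vec.dependent_biggerset_general) simp
  then obtain u x where u: "(\<Sum>x\<in>?S. u x *s x) = 0" "x \<in> ?S" "u x \<noteq> 0"
    by (subst (asm) vec.dependent_finite) auto
  let ?p = "\<Sum>i\<le>CARD('n). monom (u (?f i)) i"
  from u obtain m where m: "m \<le> CARD('n)" "u (?f m) \<noteq> 0" by auto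
  have "coeff ?p m = u (?f m)"
    using m by (simp add: coeff_sum sum.delta)
  then have "?p \<noteq> 0" using m by (metis coeff_0)
  moreover have "poly_act C ?p v = (\<Sum>x\<in>?S. u x *s x)"
    using True by (simp add: poly_act_sum poly_act_monom sum.reindex)
  ultimately show ?thesis using u(1) by metis
qed

text \<open>
  A backward orbit of \<open>C\<close> is a sequence with \<open>C x\<^sub>k\<^sub>+\<^sub>1 = x\<^sub>k\<close>. Summability can be lifted through a linear
  factor \<open>C - z\<close>: if \<open>|z| \<le> 1\<close>, then \<open>z\<close> is no eigenvalue and \<open>C - z\<close> is bounded below; if \<open>|z| > 1\<close>,
  then with \<open>y\<^sub>k = (C - z) x\<^sub>k\<close> one has \<open>|z| |x\<^sub>k\<^sub>+\<^sub>1| \<le> |x\<^sub>k| + |y\<^sub>k\<^sub>+\<^sub>1|\<close>, which bounds the partial sums.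
\<close>

lemma backward_orbit_summable_step:
  fixes C :: "complex ^ 'n ^ 'n"
  assumes ev: "\<And>z v. C *v v = z *s v \<Longrightarrow> v \<noteq> 0 \<Longrightarrow> 1 < cmod z"
    and x: "\<And>k. C *v x (Suc k) = x k"
    and summ: "summable (\<lambda>k. norm (C *v x k - z *s x k))"
  shows "summable (\<lambda>k. norm (x k))"
proof (cases "cmod z \<le> 1")
  case True
  let ?T = "\<lambda>v. C *v v - z *s v"
  have lin: "linear ?T"
    by (rule linearI) (simp_all add: vec_eq_iff matrix_vector_mult_def sum.distrib
        scaleR_sum_right algebra_simps)
  have "inj ?T"
    unfolding linear_injective_0[OF lin] using ev True by fastforce
  then obtain b where b: "b > 0" "\<And>v. b * norm v \<le> norm (?T v)"
    using linear_inj_bounded_below_pos[OF lin] by (metis mult.commute)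
  show ?thesis
  proof (rule summable_comparison_test')
    show "summable (\<lambda>k. norm (?T (x k)) / b)" using summ by (rule summable_divide)
    show "norm (norm (x k)) \<le> norm (?T (x k)) / b" for k
      using b by (simp add: field_simps)
  qed
next
  case False
  let ?y = "\<lambda>k. C *v x k - z *s x k"
  have step: "cmod z * norm (x (Suc k)) \<le> norm (x k) + norm (?y (Suc k))" for k
  proof -
    have "norm (z *s x (Suc k)) = norm (x k - ?y (Suc k))" using x by simp
    moreover have "norm (z *s x (Suc k)) = cmod z * norm (x (Suc k))"
      by (rule norm_vector_scalar_mult)
    ultimately show ?thesis by (metis norm_triangle_ineq4)
  qed
  define Y where "Y = (\<Sum>k. norm (?y k))"
  have "(\<Sum>k<n. norm (x k)) \<le> (Y + cmod z * norm (x 0)) / (cmod z - 1)" for n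
  proof -
    let ?S = "\<Sum>k<n. norm (x k)"
    have "(\<Sum>k<Suc n. cmod z * norm (x k)) = cmod z * norm (x 0) + (\<Sum>k<n. cmod z * norm (x (Suc k)))"
      by (rule sum.lessThan_Suc_shift)
    also have "\<dots> \<le> cmod z * norm (x 0) + (\<Sum>k<n. norm (x k) + norm (?y (Suc k)))"
      by (intro add_left_mono sum_mono step)
    also have "\<dots> = cmod z * norm (x 0) + ?S + (\<Sum>k<n. norm (?y (Suc k)))"
      by (simp add: sum.distrib)
    also have "(\<Sum>k<n. norm (?y (Suc k))) \<le> (\<Sum>k<Suc n. norm (?y k))"
      by (subst sum.lessThan_Suc_shift) simp
    also have "\<dots> \<le> Y" unfolding Y_def by (rule sum_le_suminf[OF summ]) auto
    finally have "cmod z * (\<Sum>k<Suc n. norm (x k)) \<le> cmod z * norm (x 0) + ?S + Y"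
      by (simp only: sum_distrib_left)
    moreover have "cmod z * ?S \<le> cmod z * (\<Sum>k<Suc n. norm (x k))"
      by (intro mult_left_mono) auto
    ultimately have "cmod z * ?S \<le> cmod z * norm (x 0) + ?S + Y" by (rule order_trans[rotated])
    then have "?S * (cmod z - 1) \<le> Y + cmod z * norm (x 0)"
      by (simp add: algebra_simps)
    then show ?thesis using False by (simp add: pos_le_divide_eq)
  qed
  then show ?thesis by (intro summableI_nonneg_bounded) auto
qed

text \<open>
  An annihilating polynomial of \<open>x\<^sub>0\<close> annihilates the whole orbit because \<open>C\<close> is injective. Its linear
  factors are then stripped off one at a time.
\<close>

lemma backward_orbit_summable:
  fixes C :: "complex ^ 'n ^ 'n"
  assumes ev: "\<And>z v. C *v v = z *s v \<Longrightarrow> v \<noteq> 0 \<Longrightarrow> 1 < cmod z"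
    and x: "\<And>k. C *v x (Suc k) = x k"
  shows "summable (\<lambda>k. norm (x k))"
proof -
  have inj: "v = 0" if "C *v v = 0" for v
    using ev[of v 0] that by fastforce
  obtain p where p: "p \<noteq> 0" "poly_act C p (x 0) = 0"
    using annihilating_poly_exists by blast
  have "poly_act C p (x k) = 0" for k
    using p(2) by (induction k) (metis x poly_act_matrix inj)+
  then have "summable (\<lambda>k. norm (poly_act C p (x k)))" by simp
  with p(1) show ?thesis
  proof (induction "degree p" arbitrary: p)
    case 0
    then obtain c where c: "p = [:c:]" by (metis degree_eq_zeroE)
    have "summable (\<lambda>k. cmod c * norm (x k))"
      using 0 by (simp add: c norm_vector_scalar_mult)
    then show ?case using 0 by (subst (asm) summable_cmult_iff) (auto simp: c)
  next
    case (Suc d)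
    then have "\<not> constant (poly p)" by (simp add: constant_degree)
    then obtain z where "poly p z = 0"
      using fundamental_theorem_of_algebra by blast
    then obtain q where q: "p = [:- z, 1:] * q" by (auto simp: poly_eq_0_iff_dvd)
    have "q \<noteq> 0" using Suc.prems q by auto
    moreover from this have "degree q = d" using Suc.hyps(2) q by (simp add: degree_mult_eq del: mult_pCons_left)
    moreover have "summable (\<lambda>k. norm (poly_act C q (x k)))"
    proof (rule backward_orbit_summable_step[OF ev])
      show "C *v poly_act C q (x (Suc k)) = poly_act C q (x k)" for k
        by (metis x poly_act_matrix)
      show "summable (\<lambda>k. norm (C *v poly_act C q (x k) - z *s poly_act C q (x k)))"
        using Suc.prems(2) unfolding q poly_act_linear_factor .
    qed
    ultimately show ?case using Suc.hyps(1) by blast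
  qed
qed

text \<open>
  Summability of \<open>\<Sum>\<^sub>k |B\<^sup>-\<^sup>k v|\<close> is all that is used of the eigenvalue condition: it gives both
  \<open>B\<^sup>-\<^sup>k \<rightarrow> 0\<close> and the boundedness of radix expansions.
\<close>

lemma expanding_inverse_powers_summable:
  fixes B A :: "real ^ 'n ^ 'n"
  assumes exp: "expanding B" and BA: "B ** A = mat 1"
  shows "summable (\<lambda>k. norm (((*v) A ^^ k) v))"
proof -
  define c :: "real ^ 'n \<Rightarrow> complex ^ 'n" where "c = (\<lambda>v. \<chi> i. complex_of_real (v $ i))"
  let ?C = "map_matrix complex_of_real B"
  have norm_c: "norm (c w) = norm w" for w
    by (simp add: c_def norm_vec_def)
  have C_c: "?C *v c w = c (B *v w)" for w
    by (simp add: c_def vec_eq_iff matrix_vector_mult_def)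
  have "summable (\<lambda>k. norm (c (((*v) A ^^ k) v)))"
  proof (rule backward_orbit_summable)
    show "1 < cmod z" if "?C *v w = z *s w" "w \<noteq> 0" for w z
      using exp that unfolding expanding_def complex_eigenvalue_def by blast
    show "?C *v c (((*v) A ^^ Suc k) v) = c (((*v) A ^^ k) v)" for k
      by (simp add: C_c matrix_vector_mul_assoc BA)
  qed
  then show ?thesis by (simp add: norm_c)
qed

section \<open>Digit expansions and cubes\<close>

lemma digit_expansion_Suc:
  "digit_expansion B (Suc s) (l(s := d)) = digit_expansion B s l + ((*v) B ^^ s) d"
  by (simp add: digit_expansion_def)

lemma UN_PiE_Suc:
  "(\<Union>l\<in>{..<Suc s} \<rightarrow>\<^sub>E D. F l) = (\<Union>d\<in>D. \<Union>l\<in>{..<s} \<rightarrow>\<^sub>E D. F (l(s := d)))"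
  unfolding lessThan_Suc PiE_insert_eq by auto blast

lemma emeasure_digit_measure_approx_card:
  assumes "A \<in> sets borel" "finite D"
  shows "emeasure (digit_measure_approx B D s) A =
    of_nat (card {l \<in> {..<s} \<rightarrow>\<^sub>E D. digit_expansion B s l \<in> A})"
proof -
  have "emeasure (digit_measure_approx B D s) A =
      (\<Sum>l\<in>{..<s} \<rightarrow>\<^sub>E D. if digit_expansion B s l \<in> A then 1 else 0)"
    using assms by (simp add: emeasure_digit_measure_approx indicator_def of_bool_def)
  also have "\<dots> = (\<Sum>l\<in>{l \<in> {..<s} \<rightarrow>\<^sub>E D. digit_expansion B s l \<in> A}. 1)"
    using assms by (subst sum.inter_filter) (auto intro: finite_PiE)
  finally show ?thesis by simp
qed

lemma cube_eq_cbox: "cube N z = cbox (z - (\<chi> i. N / 2)) (z + (\<chi> i. N / 2))"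
proof -
  have "\<bar>a - b\<bar> \<le> N / 2 \<longleftrightarrow> b - N / 2 \<le> a \<and> a \<le> b + N / 2" for a b :: real by linarith
  then show ?thesis by (auto simp: cube_def mem_box_cart)
qed

lemma cube_borel [measurable, simp]: "cube N z \<in> sets borel"
  by (simp add: cube_eq_cbox)

lemma lmeasurable_cube: "cube N z \<in> lmeasurable"
  by (simp add: cube_eq_cbox)

lemma measure_cube:
  fixes z :: "real ^ 'n"
  assumes "N \<ge> 0"
  shows "measure lebesgue (cube N z) = N ^ CARD('n)"
proof -
  have "z \<in> cube N z" using assms by (simp add: cube_def)
  then have "measure lebesgue (cube N z) = (\<Prod>i\<in>(UNIV :: 'n set). N)"
    unfolding cube_eq_cbox using content_cbox_cart[of "z - (\<chi> i. N / 2)" "z + (\<chi> i. N / 2)"] by auto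
  then show ?thesis by simp
qed

lemma cube_sym: "y \<in> cube N z \<longleftrightarrow> z \<in> cube N y"
  by (simp add: cube_def abs_minus_commute)

lemma norm_cube_le:
  fixes z :: "real ^ 'n"
  assumes "y \<in> cube N z"
  shows "norm (y - z) \<le> real CARD('n) * (N / 2)"
proof -
  have "norm (y - z) \<le> (\<Sum>i\<in>UNIV. \<bar>(y - z) $ i\<bar>)" by (rule norm_le_l1_cart)
  also have "\<dots> \<le> real CARD('n) * (N / 2)"
    using assms by (intro sum_bounded_above) (simp add: cube_def)
  finally show ?thesis .
qed

lemma closure_UN_finite: "finite I \<Longrightarrow> closure (\<Union>i\<in>I. f i) = (\<Union>i\<in>I. closure (f i))"
  by (induction I rule: finite_induct) auto

lemma inverse_inverse_ennreal: "inverse (inverse x) = (x :: ennreal)"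
proof (cases x)
  case (real r)
  then show ?thesis by (cases "r = 0") (simp_all add: inverse_ennreal)
qed simp

section \<open>Digit systems\<close>

text \<open>
  The standing hypotheses: an expanding matrix and a digit set containing \<open>0\<close> with \<open>|det B|\<close> elements.
  In particular \<open>|det B| > 0\<close>, so \<open>B\<close> is invertible; \<open>A\<close> denotes its inverse.
\<close>

locale digit_system =
  fixes B :: "real ^ 'n ^ 'n" and D :: "(real ^ 'n) set"
  assumes expanding: "expanding B"
    and finite_D: "finite D"
    and zero_in_D: "0 \<in> D"
    and card_D: "real (card D) = \<bar>det B\<bar>"
begin

abbreviation "A \<equiv> matrix_inv B"

lemma det_nonzero: "det B \<noteq> 0"
  using card_D finite_D zero_in_D by (metis abs_0 card_0_eq empty_iff of_nat_0_eq_iff)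

lemma inverse_right: "B ** A = mat 1" and inverse_left: "A ** B = mat 1"
proof -
  have "invertible B" using det_nonzero invertible_det_nz by blast
  then have "B ** A = mat 1 \<and> A ** B = mat 1"
    unfolding invertible_def matrix_inv_def by (rule someI_ex)
  then show "B ** A = mat 1" "A ** B = mat 1" by auto
qed

lemma B_A [simp]: "B *v (A *v x) = x" and A_B [simp]: "A *v (B *v x) = x"
  by (simp_all add: matrix_vector_mul_assoc inverse_right inverse_left)

lemma linear_A_power: "linear ((*v) A ^^ s)" and linear_B_power: "linear ((*v) B ^^ s)"
  by (induction s) (simp_all add: linear_iff matrix_vector_right_distrib matrix_vector_mult_scaleR)

lemma A_power_B_power [simp]: "((*v) A ^^ s) (((*v) B ^^ s) x) = x"
  by (induction s arbitrary: x) (simp_all only: funpow.simps(1) id_apply comp_apply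
      funpow_Suc_right[of _ "(*v) A"] funpow.simps(2)[of _ "(*v) B"] A_B)

lemma B_power_A_power [simp]: "((*v) B ^^ s) (((*v) A ^^ s) x) = x"
  by (induction s arbitrary: x) (simp_all only: funpow.simps(1) id_apply comp_apply
      funpow_Suc_right[of _ "(*v) B"] funpow.simps(2)[of _ "(*v) A"] B_A)

lemma inverse_power_summable: "summable (\<lambda>k. norm (((*v) A ^^ k) v))"
  by (rule expanding_inverse_powers_summable[OF expanding inverse_right])

lemma inverse_power_bound:
  obtains c where "c \<longlonglongrightarrow> 0" "\<And>s v. norm (((*v) A ^^ s) v) \<le> c s * norm v"
proof
  let ?c = "\<lambda>s. \<Sum>i\<in>UNIV. norm (((*v) A ^^ s) (axis i 1))"
  show "?c \<longlonglongrightarrow> 0"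
    by (rule tendsto_null_sum) (rule summable_LIMSEQ_zero[OF inverse_power_summable])
  fix s and v :: "real ^ 'n"
  have "v = (\<Sum>i\<in>UNIV. v $ i *\<^sub>R axis i 1)"
    using basis_expansion[of v] by (simp add: scalar_mult_eq_scaleR)
  then have "((*v) A ^^ s) v = (\<Sum>i\<in>UNIV. v $ i *\<^sub>R ((*v) A ^^ s) (axis i 1))"
    by (metis (no_types, lifting) linear_sum[OF linear_A_power] linear_scale[OF linear_A_power] sum.cong)
  also have "norm \<dots> \<le> (\<Sum>i\<in>UNIV. norm (((*v) A ^^ s) (axis i 1)) * norm v)"
    by (rule sum_norm_le) (simp add: mult.commute mult_right_mono component_le_norm_cart)
  finally show "norm (((*v) A ^^ s) v) \<le> ?c s * norm v" by (simp add: sum_distrib_right)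
qed

section \<open>The self-affine set\<close>

text \<open>
  The compact non-empty solutions of the set equation.
\<close>

definition invariant :: "(real ^ 'n) set \<Rightarrow> bool" where
  "invariant K \<longleftrightarrow> compact K \<and> K \<noteq> {} \<and> (*v) B ` K = (\<Union>d\<in>D. (\<lambda>x. x + d) ` K)"

lemma invariant_bounded: "invariant K \<Longrightarrow> \<exists>r. \<forall>x\<in>K. norm x \<le> r"
  by (metis invariant_def compact_imp_bounded bounded_iff)

text \<open>
  The finite radix expansions \<open>B\<^sup>-\<^sup>1 d\<^sub>1 + \<dots> + B\<^sup>-\<^sup>s d\<^sub>s\<close> with digits in \<open>D\<close>. The digits are a
  sequence defined on all of \<open>\<nat>\<close>, of which only the first \<open>s\<close> terms (numbered from \<open>0\<close>) matter.
\<close>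

definition radix_fractions :: "(real ^ 'n) set" where
  "radix_fractions = {\<Sum>k<s. ((*v) A ^^ Suc k) (f k) |s f. \<forall>k. f k \<in> D}"

lemma bounded_radix_fractions: "bounded radix_fractions"
proof -
  have "norm x \<le> (\<Sum>d\<in>D. \<Sum>k. norm (((*v) A ^^ Suc k) d))" if mem: "x \<in> radix_fractions" for x
  proof -
    obtain s f where x: "x = (\<Sum>k<s. ((*v) A ^^ Suc k) (f k))" and f: "\<forall>k. f k \<in> D"
      using mem unfolding radix_fractions_def by blast
    have "norm x \<le> (\<Sum>k<s. norm (((*v) A ^^ Suc k) (f k)))"
      unfolding x by (rule norm_sum)
    also have "\<dots> \<le> (\<Sum>k<s. \<Sum>d\<in>D. norm (((*v) A ^^ Suc k) d))"
      using f by (intro sum_mono member_le_sum finite_D) auto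
    also have "\<dots> = (\<Sum>d\<in>D. \<Sum>k<s. norm (((*v) A ^^ Suc k) d))"
      by (rule sum.swap)
    also have "\<dots> \<le> (\<Sum>d\<in>D. \<Sum>k. norm (((*v) A ^^ Suc k) d))"
    proof (rule sum_mono)
      fix d
      have "summable (\<lambda>k. norm (((*v) A ^^ Suc k) d))"
        by (subst summable_Suc_iff) (rule inverse_power_summable)
      then show "(\<Sum>k<s. norm (((*v) A ^^ Suc k) d)) \<le> (\<Sum>k. norm (((*v) A ^^ Suc k) d))"
        by (rule sum_le_suminf) auto
    qed
    finally show ?thesis .
  qed
  then show ?thesis by (auto simp: bounded_iff)
qed

text \<open>
  Multiplying by \<open>B\<close> splits off the leading digit. The set of finite expansions is itself a
  solution of the set equation; the empty expansion is accounted for by the digit \<open>0\<close>.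
\<close>

lemma radix_fractions_invariant:
  "(*v) B ` radix_fractions = (\<Union>d\<in>D. (\<lambda>x. x + d) ` radix_fractions)"
proof (intro subset_antisym subsetI)
  fix y assume "y \<in> (*v) B ` radix_fractions"
  then obtain s f where y: "y = B *v (\<Sum>k<s. ((*v) A ^^ Suc k) (f k))" and f: "\<forall>k. f k \<in> D"
    unfolding radix_fractions_def by blast
  have y': "y = (\<Sum>k<s. ((*v) A ^^ k) (f k))"
    by (simp add: y linear_sum[OF matrix_vector_mul_linear])
  show "y \<in> (\<Union>d\<in>D. (\<lambda>x. x + d) ` radix_fractions)"
  proof (cases s)
    case 0
    then have "y = 0" by (simp add: y')
    moreover have "0 \<in> radix_fractions"
      unfolding radix_fractions_def using f by (auto intro!: exI[of _ 0])
    ultimately show ?thesis using zero_in_D by force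
  next
    case (Suc t)
    have "y = (\<Sum>k<t. ((*v) A ^^ Suc k) (f (Suc k))) + f 0"
      unfolding y' Suc sum.lessThan_Suc_shift by simp
    moreover have "(\<Sum>k<t. ((*v) A ^^ Suc k) (f (Suc k))) \<in> radix_fractions"
      unfolding radix_fractions_def using f by (intro CollectI exI[of _ t] exI[of _ "\<lambda>k. f (Suc k)"]) auto
    ultimately show ?thesis using f by blast
  qed
next
  fix y assume "y \<in> (\<Union>d\<in>D. (\<lambda>x. x + d) ` radix_fractions)"
  then obtain d s f where d: "d \<in> D" and y: "y = (\<Sum>k<s. ((*v) A ^^ Suc k) (f k)) + d"
    and f: "\<forall>k. f k \<in> D"
    unfolding radix_fractions_def by blast
  let ?g = "case_nat d f"
  have "(\<Sum>k<Suc s. ((*v) A ^^ Suc k) (?g k)) = A *v y"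
    unfolding sum.lessThan_Suc_shift y
    by (simp add: linear_sum[OF matrix_vector_mul_linear] matrix_vector_right_distrib)
  moreover have "(\<Sum>k<Suc s. ((*v) A ^^ Suc k) (?g k)) \<in> radix_fractions"
    unfolding radix_fractions_def using f d
    by (intro CollectI exI[of _ "Suc s"] exI[of _ ?g]) (auto split: nat.split)
  ultimately show "y \<in> (*v) B ` radix_fractions" by (metis B_A image_eqI)
qed

lemma zero_in_radix_fractions: "0 \<in> radix_fractions"
  unfolding radix_fractions_def using zero_in_D by (intro CollectI exI[of _ 0] exI[of _ "\<lambda>_. 0"]) auto

lemma invariant_closure_radix_fractions: "invariant (closure radix_fractions)"
proof -
  have "inj ((*v) B)" by (metis A_B injI)
  then have "(*v) B ` closure radix_fractions = closure (\<Union>d\<in>D. (\<lambda>x. x + d) ` radix_fractions)"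
    by (simp only: closure_injective_linear_image[OF matrix_vector_mul_linear]
        radix_fractions_invariant)
  also have "\<dots> = (\<Union>d\<in>D. closure ((\<lambda>x. x + d) ` radix_fractions))"
    by (rule closure_UN_finite[OF finite_D])
  also have "\<dots> = (\<Union>d\<in>D. (\<lambda>x. x + d) ` closure radix_fractions)"
    using closure_translation[of _ radix_fractions] by (simp add: add.commute[of _ "_ :: real ^ 'n"])
  finally show ?thesis
    using bounded_radix_fractions zero_in_radix_fractions
    by (auto simp: invariant_def compact_closure)
qed

text \<open>
  Iterating the set equation: \<open>B\<^sup>s K\<close> is the union of the translates of \<open>K\<close> by the digit expansions
  of length \<open>s\<close>.
\<close>

lemma invariant_power:
  assumes "invariant K"
  shows "((*v) B ^^ s) ` K = (\<Union>l\<in>{..<s} \<rightarrow>\<^sub>E D. (+) (digit_expansion B s l) ` K)"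
proof (induction s)
  case 0
  then show ?case by (simp add: digit_expansion_def)
next
  case (Suc s)
  let ?P = "(*v) B ^^ s"
  have "((*v) B ^^ Suc s) ` K = ?P ` (\<Union>d\<in>D. (\<lambda>x. x + d) ` K)"
    using assms by (simp add: invariant_def funpow_swap1 flip: image_image)
  also have "\<dots> = (\<Union>d\<in>D. (\<lambda>x. x + ?P d) ` ?P ` K)"
    by (simp add: image_UN image_image linear_add[OF linear_B_power])
  also have "\<dots> = (\<Union>d\<in>D. \<Union>l\<in>{..<s} \<rightarrow>\<^sub>E D. (+) (digit_expansion B (Suc s) (l(s := d))) ` K)"
    unfolding Suc.IH digit_expansion_Suc by (simp add: image_UN image_image algebra_simps)
  also have "\<dots> = (\<Union>l\<in>{..<Suc s} \<rightarrow>\<^sub>E D. (+) (digit_expansion B (Suc s) l) ` K)"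
    by (rule UN_PiE_Suc[symmetric])
  finally show ?case .
qed

text \<open>
  Uniqueness. If \<open>B\<^sup>s x = x\<^sub>l + z\<close> with \<open>z \<in> K\<close>, then for any \<open>y \<in> L\<close> the same digits give a point
  \<open>w \<in> L\<close> with \<open>B\<^sup>s w = x\<^sub>l + y\<close>, and \<open>w - x = B\<^sup>-\<^sup>s (y - z)\<close> tends to \<open>0\<close>.
\<close>

lemma invariant_subset:
  assumes K: "invariant K" and L: "invariant L"
  shows "K \<subseteq> L"
proof
  fix x assume x: "x \<in> K"
  obtain y where y: "y \<in> L" using L by (auto simp: invariant_def)
  obtain r where r: "\<And>z. z \<in> K \<Longrightarrow> norm z \<le> r"
    using invariant_bounded[OF K] by blast
  obtain c where c: "c \<longlonglongrightarrow> 0" "\<And>s v. norm (((*v) A ^^ s) v) \<le> c s * norm v"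
    using inverse_power_bound by blast
  have "\<exists>w\<in>L. norm (w - x) \<le> \<bar>c s\<bar> * (norm y + r)" for s
  proof -
    have "((*v) B ^^ s) x \<in> ((*v) B ^^ s) ` K" using x by blast
    then obtain l z where l: "l \<in> {..<s} \<rightarrow>\<^sub>E D" and z: "z \<in> K"
      and xz: "((*v) B ^^ s) x = digit_expansion B s l + z"
      unfolding invariant_power[OF K] by auto
    have "digit_expansion B s l + y \<in> ((*v) B ^^ s) ` L"
      unfolding invariant_power[OF L] using l y by blast
    then obtain w where w: "w \<in> L" "((*v) B ^^ s) w = digit_expansion B s l + y" by force
    have "w - x = ((*v) A ^^ s) (((*v) B ^^ s) (w - x))" by simp
    also have "((*v) B ^^ s) (w - x) = y - z"
      using w xz by (simp add: linear_diff[OF linear_B_power])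
    finally have "norm (w - x) \<le> c s * norm (y - z)" using c(2)[of s "y - z"] by metis
    also have "\<dots> \<le> \<bar>c s\<bar> * (norm y + r)"
      using r[OF z] norm_triangle_ineq4[of y z] by (intro mult_mono) auto
    finally show ?thesis using w by blast
  qed
  then obtain w where w: "\<And>s. w s \<in> L" "\<And>s. norm (w s - x) \<le> \<bar>c s\<bar> * (norm y + r)" by metis
  have "w \<longlonglongrightarrow> x"
  proof (rule LIM_zero_cancel, rule Lim_null_comparison)
    show "(\<lambda>s. \<bar>c s\<bar> * (norm y + r)) \<longlonglongrightarrow> 0"
      using c(1) by (intro tendsto_mult_left_zero tendsto_rabs_zero)
  qed (simp add: w(2))
  moreover have "closed L" using L compact_imp_closed by (auto simp: invariant_def)
  ultimately show "x \<in> L" using w(1) closed_sequentially by blast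
qed

abbreviation "K \<equiv> self_affine_set B D"

lemma self_affine_set_eq: "K = closure radix_fractions"
  unfolding self_affine_set_def
proof (rule the_equality)
  show "compact (closure radix_fractions) \<and> closure radix_fractions \<noteq> {} \<and>
      (*v) B ` closure radix_fractions = (\<Union>d\<in>D. (\<lambda>x. x + d) ` closure radix_fractions)"
    using invariant_closure_radix_fractions by (simp add: invariant_def)
  show "L = closure radix_fractions"
    if "compact L \<and> L \<noteq> {} \<and> (*v) B ` L = (\<Union>d\<in>D. (\<lambda>x. x + d) ` L)" for L
    using that invariant_closure_radix_fractions
    by (intro subset_antisym invariant_subset) (auto simp: invariant_def)
qed

lemma invariant_K: "invariant K"
  unfolding self_affine_set_eq by (rule invariant_closure_radix_fractions)

lemma zero_in_K: "0 \<in> K"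
  unfolding self_affine_set_eq using zero_in_radix_fractions closure_subset by blast

lemma lmeasurable_K: "K \<in> lmeasurable"
  using invariant_K by (auto simp: invariant_def intro: lmeasurable_compact)

section \<open>Counting digit expansions in a cube\<close>

lemma
  assumes "S \<in> lmeasurable"
  shows lmeasurable_B_power: "((*v) B ^^ s) ` S \<in> lmeasurable"
    and measure_B_power: "measure lebesgue (((*v) B ^^ s) ` S) = real (card D) ^ s * measure lebesgue S"
proof -
  have "((*v) B ^^ s) ` S \<in> lmeasurable \<and>
      measure lebesgue (((*v) B ^^ s) ` S) = real (card D) ^ s * measure lebesgue S"
  proof (induction s)
    case (Suc s)
    have "((*v) B ^^ Suc s) ` S = (*v) B ` ((*v) B ^^ s) ` S" by (simp add: image_image)
    then show ?case using Suc.IH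
      by (simp only: lmeasurable_matrix_image measure_matrix_image card_D power_Suc mult.assoc simp_thms)
  qed (use assms in simp)
  then show "((*v) B ^^ s) ` S \<in> lmeasurable"
    "measure lebesgue (((*v) B ^^ s) ` S) = real (card D) ^ s * measure lebesgue S" by auto
qed

lemma card_tuples: "card ({..<s :: nat} \<rightarrow>\<^sub>E D) = card D ^ s"
  by (simp add: card_PiE)

lemma finite_tuples: "finite ({..<s :: nat} \<rightarrow>\<^sub>E D)"
  by (intro finite_PiE) (auto simp: finite_D)

text \<open>
  There are \<open>q\<^sup>s\<close> translates \<open>K + x\<^sub>l\<close>, where \<open>q = card D\<close>, and their union has measure \<open>q\<^sup>s |K|\<close>. Hence
  no measure is lost in the union of any subfamily: \<open>m\<close> of the translates cover measure at least
  \<open>m |K|\<close>. Those with \<open>x\<^sub>l\<close> in a cube lie in the cube enlarged by \<open>r\<close> on every side.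
\<close>

lemma card_times_measure_le:
  assumes r: "\<And>x. x \<in> K \<Longrightarrow> norm x \<le> r" and N: "N \<ge> 0"
  shows "real (card {l \<in> {..<s} \<rightarrow>\<^sub>E D. digit_expansion B s l \<in> cube N z}) * measure lebesgue K
    \<le> (N + 2 * r) ^ CARD('n)"
proof -
  let ?x = "digit_expansion B s"
  let ?T = "{..<s} \<rightarrow>\<^sub>E D"
  let ?I = "{l \<in> ?T. ?x l \<in> cube N z}"
  let ?m = "measure lebesgue K"
  let ?U = "\<lambda>I. \<Union>l\<in>I. (+) (?x l) ` K"
  have r0: "r \<ge> 0" using r[OF zero_in_K] by simp
  have meas: "(+) (?x l) ` K \<in> lmeasurable" for l
    by (rule measurable_translation[OF lmeasurable_K])
  have fin: "finite ?I" "finite (?T - ?I)" using finite_tuples[of s] by auto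
  have U: "?U ?I \<in> lmeasurable" "?U (?T - ?I) \<in> lmeasurable"
    using fin meas by (auto intro!: fmeasurable.finite_UN)
  have "real (card D) ^ s * ?m = measure lebesgue (?U ?T)"
    using measure_B_power[OF lmeasurable_K] invariant_power[OF invariant_K] by simp
  also have "?U ?T = ?U ?I \<union> ?U (?T - ?I)" by blast
  also have "measure lebesgue \<dots> \<le> measure lebesgue (?U ?I) + measure lebesgue (?U (?T - ?I))"
    using U by (intro measure_Un_le) auto
  also have "measure lebesgue (?U (?T - ?I)) \<le> (\<Sum>l\<in>?T - ?I. measure lebesgue ((+) (?x l) ` K))"
    using fin meas by (intro measure_UNION_le) auto
  also have "\<dots> = real (card (?T - ?I)) * ?m" by (simp add: measure_translation)
  also have "card (?T - ?I) = card D ^ s - card ?I"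
    using finite_tuples by (subst card_Diff_subset) (auto simp: card_tuples)
  also have "real (card D ^ s - card ?I) = real (card D) ^ s - real (card ?I)"
    using card_mono[of ?T ?I] finite_tuples by (subst of_nat_diff) (auto simp: card_tuples)
  also have "measure lebesgue (?U ?I) \<le> measure lebesgue (cube (N + 2 * r) z)"
  proof (rule measure_mono_fmeasurable[OF _ _ lmeasurable_cube])
    show "?U ?I \<subseteq> cube (N + 2 * r) z"
    proof
      fix y assume "y \<in> ?U ?I"
      then obtain l k where lk: "?x l \<in> cube N z" "k \<in> K" "y = ?x l + k" by auto
      have "\<bar>y $ i - z $ i\<bar> \<le> (N + 2 * r) / 2" for i
      proof -
        have "\<bar>k $ i\<bar> \<le> r" using r[OF lk(2)] component_le_norm_cart[of k i] by linarith
        moreover have "\<bar>?x l $ i - z $ i\<bar> \<le> N / 2" using lk(1) by (simp add: cube_def)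
        moreover have "\<bar>y $ i - z $ i\<bar> \<le> \<bar>?x l $ i - z $ i\<bar> + \<bar>k $ i\<bar>"
          using abs_triangle_ineq[of "?x l $ i - z $ i" "k $ i"] by (simp add: lk(3) algebra_simps)
        moreover have "(N + 2 * r) / 2 = N / 2 + r" by simp
        ultimately show ?thesis by linarith
      qed
      then show "y \<in> cube (N + 2 * r) z" by (simp add: cube_def)
    qed
  qed (use U in auto)
  also have "\<dots> = (N + 2 * r) ^ CARD('n)" using N r0 by (intro measure_cube) auto
  finally show ?thesis by (simp add: algebra_simps)
qed

text \<open>
  Averaging. Integrating \<open>z \<mapsto> \<mu>\<^sub>s(I\<^sub>N(z))\<close> gives \<open>q\<^sup>s N\<^sup>n\<close>, where \<open>q = card D\<close>. The integrand is at most
  \<open>S\<close>, and for large \<open>s\<close> it vanishes outside \<open>B\<^sup>s U\<close>, where \<open>U\<close> is an open neighbourhood of \<open>K\<close> with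
  measure below \<open>|K| + e\<close>: each \<open>x\<^sub>l\<close> lies in \<open>B\<^sup>s K\<close>, and \<open>B\<^sup>-\<^sup>s\<close> shrinks the cube below the distance
  from \<open>K\<close> to the complement of \<open>U\<close>.
\<close>

lemma cube_volume_le:
  assumes N: "N \<ge> 0" and e: "e > 0"
    and S: "\<And>s z. emeasure (digit_measure_approx B D s) (cube N z) \<le> S"
  shows "ennreal (N ^ CARD('n)) \<le> S * ennreal (measure lebesgue K + e)"
proof -
  let ?q = "real (card D)"
  have q: "?q > 0" using card_D det_nonzero by simp
  obtain U where U: "open U" "K \<subseteq> U" "U \<in> lmeasurable"
    and mU: "measure lebesgue U < measure lebesgue K + e"
  proof -
    obtain U where U: "open U" "K \<subseteq> U" "U - K \<in> lmeasurable" "emeasure lebesgue (U - K) < ennreal e"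
      using sets_lebesgue_outer_open[of K e] lmeasurable_K e by blast
    have eq: "U = K \<union> (U - K)" using U(2) by blast
    have meas: "U \<in> lmeasurable"
      using fmeasurable.Un[OF lmeasurable_K U(3)] eq by metis
    have "measure lebesgue U \<le> measure lebesgue K + measure lebesgue (U - K)"
      using measure_Un_le[of K lebesgue "U - K"] lmeasurable_K U(3) eq by (metis fmeasurableD)
    moreover have "measure lebesgue (U - K) < e"
      using U(3,4) e by (simp add: emeasure_eq_measure2 ennreal_less_iff)
    ultimately show ?thesis using that U(1,2) meas by force
  qed
  obtain \<delta> where \<delta>: "\<delta> > 0" "(\<Union>x\<in>K. ball x \<delta>) \<subseteq> U"
    using compact_subset_open_imp_ball_epsilon_subset invariant_K U by (metis invariant_def)
  obtain c where c: "c \<longlonglongrightarrow> 0" "\<And>s v. norm (((*v) A ^^ s) v) \<le> c s * norm v"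
    using inverse_power_bound by blast
  let ?R = "real CARD('n) * (N / 2)"
  have "(\<lambda>s. \<bar>c s\<bar> * ?R) \<longlonglongrightarrow> 0"
    using c(1) by (intro tendsto_mult_left_zero tendsto_rabs_zero)
  then obtain s where s: "\<bar>c s\<bar> * ?R < \<delta>"
    using \<delta>(1) by (metis (no_types, lifting) order_tendstoD(2) eventually_sequentially order_refl)
  let ?V = "((*v) B ^^ s) ` U"
  let ?x = "digit_expansion B s"
  let ?T = "{..<s} \<rightarrow>\<^sub>E D"
  have sub: "cube N (?x l) \<subseteq> ?V" if l: "l \<in> ?T" for l
  proof
    fix z assume z: "z \<in> cube N (?x l)"
    \<comment> \<open>This uses \<open>0 \<in> K\<close>: the point \<open>x\<^sub>l\<close> belongs to its own translate \<open>x\<^sub>l + K\<close>.\<close>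
    have "?x l \<in> ((*v) B ^^ s) ` K"
      unfolding invariant_power[OF invariant_K] using l zero_in_K by (force intro!: bexI[of _ l])
    then obtain k where k: "k \<in> K" "?x l = ((*v) B ^^ s) k" by blast
    have "norm (((*v) A ^^ s) (z - ?x l)) \<le> c s * norm (z - ?x l)" by (rule c(2))
    also have "\<dots> \<le> \<bar>c s\<bar> * ?R" using norm_cube_le[OF z] by (intro mult_mono) auto
    finally have "norm (((*v) A ^^ s) z - k) < \<delta>"
      using s by (simp add: k linear_diff[OF linear_A_power])
    then have "((*v) A ^^ s) z \<in> U"
      using \<delta>(2) k(1) by (force simp: dist_norm norm_minus_commute)
    then show "z \<in> ?V" by (metis B_power_A_power image_eqI)
  qed
  have V: "?V \<in> lmeasurable" using U(3) by (rule lmeasurable_B_power)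
  have cube: "emeasure lebesgue (cube N z) = ennreal (N ^ CARD('n))" for z :: "real ^ 'n"
    by (simp only: emeasure_eq_measure2[OF lmeasurable_cube] measure_cube[OF N])
  have "ennreal (?q ^ s) * ennreal (N ^ CARD('n)) = (\<Sum>l\<in>?T. emeasure lebesgue (cube N (?x l)))"
    by (simp add: cube card_tuples ennreal_of_nat_eq_real_of_nat)
  also have "\<dots> = (\<Sum>l\<in>?T. \<integral>\<^sup>+z. indicator (cube N (?x l)) z \<partial>lebesgue)"
    using lmeasurable_cube by (intro sum.cong refl nn_integral_indicator[symmetric]) auto
  also have "\<dots> = (\<integral>\<^sup>+z. (\<Sum>l\<in>?T. indicator (cube N (?x l)) z) \<partial>lebesgue)"
    by (intro nn_integral_sum[symmetric] borel_measurable_indicator fmeasurableD[OF lmeasurable_cube])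
  also have "\<dots> \<le> (\<integral>\<^sup>+z. S * indicator ?V z \<partial>lebesgue)"
  proof (rule nn_integral_mono)
    fix z :: "real ^ 'n"
    show "(\<Sum>l\<in>?T. indicator (cube N (?x l)) z) \<le> S * indicator ?V z"
    proof (cases "z \<in> ?V")
      case True
      have "(\<Sum>l\<in>?T. indicator (cube N (?x l)) z) =
          (\<Sum>l\<in>?T. indicator (cube N z) (?x l) :: ennreal)"
        by (intro sum.cong refl) (simp add: indicator_def cube_sym)
      also have "\<dots> = emeasure (digit_measure_approx B D s) (cube N z)"
        by (simp add: emeasure_digit_measure_approx)
      also have "\<dots> \<le> S" by (rule S)
      finally show ?thesis using True by simp
    next
      case False
      then have "(\<Sum>l\<in>?T. indicator (cube N (?x l)) z) = (0 :: ennreal)"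
        using sub by (intro sum.neutral) (auto simp: indicator_def)
      then show ?thesis by simp
    qed
  qed
  also have "\<dots> = S * emeasure lebesgue ?V"
    using V by (intro nn_integral_cmult_indicator) auto
  also have "emeasure lebesgue ?V = ennreal (?q ^ s * measure lebesgue U)"
    using V by (simp add: emeasure_eq_measure2 measure_B_power[OF U(3)])
  also have "\<dots> \<le> ennreal (?q ^ s) * ennreal (measure lebesgue K + e)"
  proof -
    have "0 \<le> measure lebesgue K + e" using e by (simp add: add_nonneg_nonneg)
    then have "ennreal (?q ^ s) * ennreal (measure lebesgue K + e) =
        ennreal (?q ^ s * (measure lebesgue K + e))"
      using q by (subst ennreal_mult) simp_all
    then show ?thesis using mU by (simp add: ennreal_leI mult_left_mono)
  qed
  finally have "ennreal (?q ^ s) * ennreal (N ^ CARD('n)) \<le>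
      ennreal (?q ^ s) * (S * ennreal (measure lebesgue K + e))"
    by (simp add: mult_left_mono mult.left_commute)
  then show ?thesis
    using q by (subst (asm) ennreal_mult_le_mult_iff) auto
qed

section \<open>The upper Beurling density\<close>

lemma emeasure_K: "emeasure lebesgue K = ennreal (measure lebesgue K)"
  by (rule emeasure_eq_measure2[OF lmeasurable_K])

lemma upper_Beurling_density_le:
  "upper_Beurling_density (digit_measure B D) \<le> inverse (emeasure lebesgue K)"
proof (cases "measure lebesgue K = 0")
  case True
  then show ?thesis by (simp add: emeasure_K)
next
  case False
  let ?m = "measure lebesgue K"
  let ?g = "\<lambda>r N. ennreal ((1 + 2 * r / N) ^ CARD('n) / ?m)"
  have m: "?m > 0" using False by (simp add: zero_less_measure_iff)
  obtain r where r: "\<And>x. x \<in> K \<Longrightarrow> norm x \<le> r"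
    using invariant_bounded[OF invariant_K] by blast
  have r0: "r \<ge> 0" using r[OF zero_in_K] by simp
  have bound: "emeasure (digit_measure B D) (cube N z) / ennreal (N ^ CARD('n)) \<le> ?g r N"
    if N: "N > 0" for N and z :: "real ^ 'n"
  proof -
    have "emeasure (digit_measure B D) (cube N z) \<le> ennreal ((N + 2 * r) ^ CARD('n) / ?m)"
      unfolding emeasure_digit_measure[OF cube_borel finite_D zero_in_D]
    proof (rule SUP_least)
      fix s
      have "real (card {l \<in> {..<s} \<rightarrow>\<^sub>E D. digit_expansion B s l \<in> cube N z}) \<le> (N + 2 * r) ^ CARD('n) / ?m"
        using card_times_measure_le[OF r, of N s z] N m by (simp add: pos_le_divide_eq)
      then show "emeasure (digit_measure_approx B D s) (cube N z) \<le> ennreal ((N + 2 * r) ^ CARD('n) / ?m)"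
        unfolding emeasure_digit_measure_approx_card[OF cube_borel finite_D] ennreal_of_nat_eq_real_of_nat
        by (rule ennreal_leI)
    qed
    then have "emeasure (digit_measure B D) (cube N z) / ennreal (N ^ CARD('n)) \<le>
        ennreal ((N + 2 * r) ^ CARD('n) / ?m) / ennreal (N ^ CARD('n))"
      by (rule divide_right_mono_ennreal)
    also have "\<dots> = ennreal ((N + 2 * r) ^ CARD('n) / ?m / N ^ CARD('n))"
      using N r0 m by (intro divide_ennreal) auto
    also have "(N + 2 * r) ^ CARD('n) / ?m / N ^ CARD('n) = ((N + 2 * r) / N) ^ CARD('n) / ?m"
      by (simp add: power_divide)
    also have "(N + 2 * r) / N = 1 + 2 * r / N" using N by (simp add: field_simps)
    finally show ?thesis .
  qed
  have "upper_Beurling_density (digit_measure B D) \<le> Limsup at_top (?g r)"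
    unfolding upper_Beurling_density_def
    by (intro Limsup_mono eventually_mono[OF eventually_gt_at_top[of 0]] SUP_least bound)
  also have "\<dots> = ennreal ((1 + 0) ^ CARD('n) / ?m)"
  proof (rule lim_imp_Limsup)
    have "((\<lambda>N. 2 * r / N) \<longlongrightarrow> 0) at_top"
      by (rule real_tendsto_divide_at_top[OF tendsto_const filterlim_ident])
    then show "(?g r \<longlongrightarrow> ennreal ((1 + 0) ^ CARD('n) / ?m)) at_top"
      using m by (intro tendsto_ennrealI tendsto_divide tendsto_power tendsto_add tendsto_const) auto
  qed simp
  also have "\<dots> = inverse (emeasure lebesgue K)"
    using m by (simp add: emeasure_K inverse_ennreal inverse_eq_divide)
  finally show ?thesis .
qed

text \<open>
  The inequality holds for every side length \<open>N > 0\<close>, before passing to the limit. It includes the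
  case \<open>|K| = 0\<close>, where the supremum over the cubes is infinite.
\<close>

lemma le_upper_Beurling_density:
  "inverse (emeasure lebesgue K) \<le> upper_Beurling_density (digit_measure B D)"
proof -
  let ?m = "measure lebesgue K"
  have "inverse (emeasure lebesgue K) \<le>
      (SUP z. emeasure (digit_measure B D) (cube N z) / ennreal (N ^ CARD('n)))"
    if N: "N > 0" for N :: real
  proof -
    define S where "S = (SUP z. emeasure (digit_measure B D) (cube N z))"
    define V where "V = N ^ CARD('n)"
    have V: "V > 0" using N by (simp add: V_def)
    have approx: "ennreal V \<le> S * ennreal (?m + e)" if "e > 0" for e
      unfolding V_def
    proof (rule cube_volume_le[OF _ that])
      fix s and z :: "real ^ 'n"
      have "emeasure (digit_measure_approx B D s) (cube N z) \<le> emeasure (digit_measure B D) (cube N z)"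
        unfolding emeasure_digit_measure[OF cube_borel finite_D zero_in_D] by (rule SUP_upper) simp
      also have "\<dots> \<le> S" unfolding S_def by (rule SUP_upper) simp
      finally show "emeasure (digit_measure_approx B D s) (cube N z) \<le> S" .
    qed (use N in simp)
    have "inverse (ennreal ?m) \<le> S / ennreal V"
    proof (cases S)
      case top
      then show ?thesis by (simp add: ennreal_top_divide)
    next
      case (real S')
      have "V \<le> S' * ?m"
      proof (rule field_le_epsilon)
        fix d :: real assume d: "d > 0"
        let ?e = "d / (S' + 1)"
        have e: "?e > 0" using d real by simp
        have "V \<le> S' * (?m + ?e)"
          using approx[OF e] e real V by (simp add: ennreal_mult[symmetric] del: ennreal_plus)
        also have "\<dots> \<le> S' * ?m + d" using d real by (simp add: field_simps)
        finally show "V \<le> S' * ?m + d" .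
      qed
      moreover from this have "?m > 0"
        using V real by (metis measure_nonneg mult_zero_right not_less order_le_less)
      ultimately have "inverse ?m \<le> S' / V" using V by (simp add: field_simps)
      then show ?thesis
        using \<open>?m > 0\<close> V real by (simp add: inverse_ennreal divide_ennreal)
    qed
    also have "S / ennreal V = (SUP z. emeasure (digit_measure B D) (cube N z) / ennreal V)"
      unfolding S_def by (rule SUP_divide_ennreal)
    finally show ?thesis by (simp add: emeasure_K V_def)
  qed
  then show ?thesis
    unfolding upper_Beurling_density_def
    by (intro le_Limsup eventually_mono[OF eventually_gt_at_top[of 0]]) auto
qed

end

theorem theorem1p2:
  fixes B :: "real ^ 'n ^ 'n" and D :: "(real ^ 'n) set"
  assumes "expanding B"
    and "\<bar>det B\<bar> \<in> \<int>"
    and "finite D"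
    and "0 \<in> D"
    and "real (card D) = \<bar>det B\<bar>"
  shows "inverse (emeasure lebesgue (self_affine_set B D)) =
           upper_Beurling_density (digit_measure B D)
       \<and> emeasure lebesgue (self_affine_set B D) =
           inverse (upper_Beurling_density (digit_measure B D))"
proof -
  interpret digit_system B D
    using assms by unfold_locales
  have "inverse (emeasure lebesgue K) = upper_Beurling_density (digit_measure B D)"
    using upper_Beurling_density_le le_upper_Beurling_density by (rule antisym[rotated])
  then show ?thesis using inverse_inverse_ennreal[of "emeasure lebesgue K"] by simp
qed

end
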